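(* There are absolute constants $k_5>0$ and $k_6>1$ such that for every integer $c\ge 3$, with $\omega$ denoting the number of distinct prime factors of $c$, $$G_{c}^{\frac{2}{\varphi(c)}} < k_{5}\,k_{6}^{3^{\omega}}\,R(c)\,c^{2},$$ where $k_6^{3^{\omega}}$ means $k_6$ raised to the power $3^{\omega}$.
   Context: For a positive integer $n$, $R(n)$ denotes its radical, i.e. the product of the distinct primes dividing $n$ (with $R(1)=1$), and $\varphi$ is Euler's totient function. For an integer $c\ge 3$, the equation $x+y=c$ in positive integers with $\gcd(x,y)=1$ and $x<y$ has exactly $\varphi(c)/2$ solutions; denote them $(a_i,b_i)$, $1\le i\le \varphi(c)/2$. Define $$G_c=\prod_{1\le i\le \varphi(c)/2} R(a_i b_i c).$$ *)

theory Defs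
  imports Complex_Main "HOL-Number_Theory.Number_Theory"
begin

definition rad :: "nat \<Rightarrow> nat" where
  "rad n = (\<Prod>p\<in>prime_factors n. p)"

definition omega :: "nat \<Rightarrow> nat" where
  "omega n = card (prime_factors n)"

definition solutions :: "nat \<Rightarrow> (nat \<times> nat) set" where
  "solutions c = {(a, b). 0 < a \<and> 0 < b \<and> a + b = c \<and> coprime a b \<and> a < b}"

definition G :: "nat \<Rightarrow> nat" where
  "G c = (\<Prod>(a, b)\<in>solutions c. rad (a * b * c))"

end

theory Submission
  imports Defs
begin

text \<open>
  Since \<open>R(a b c) \<le> R(c) a b \<le> R(c) c\<^sup>2\<close> and there are at most \<open>\<phi>(c) / 2\<close> solutions,
  the bound already holds without the factor \<open>k\<^sub>6\<close> up to strictness, so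
  \<open>k\<^sub>5 = 1\<close> and \<open>k\<^sub>6 = 2\<close> are admissible.
\<close>

lemma rad_pos: "rad n > 0"
  unfolding rad_def by (intro prod_pos) (auto simp: prime_gt_0_nat in_prime_factors_iff)

lemma rad_le: "n > 0 \<Longrightarrow> rad n \<le> n"
proof -
  assume n: "n > 0"
  \<comment> \<open>Compare with the prime factorization of \<open>n\<close> factor by factor: every
    exponent there is at least 1.\<close>
  have "rad n \<le> (\<Prod>p\<in>prime_factors n. p ^ multiplicity p n)"
    unfolding rad_def
  proof (intro prod_mono conjI)
    fix p assume p: "p \<in> prime_factors n"
    then have "multiplicity p n \<ge> 1" "p \<ge> 1"
      by (auto simp: prime_factors_multiplicity intro: prime_gt_0_nat Suc_leI)
    then show "p \<le> p ^ multiplicity p n"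
      by (intro self_le_power) auto
  qed simp
  also have "\<dots> = n"
    using prime_factorization_nat[OF n] by simp
  finally show ?thesis .
qed

text \<open>The primes of \<open>m * n\<close> form the union of the two sets of primes, so the
  right-hand side exceeds the left exactly by the product of the common primes, which is at least
  1.\<close>

lemma rad_mult_le:
  assumes "m > 0" "n > 0"
  shows "rad (m * n) \<le> rad m * rad n"
proof -
  let ?I = "prime_factors m \<inter> prime_factors n"
  have "rad (m * n) * (\<Prod>p\<in>?I. p) = rad m * rad n"
    using assms unfolding rad_def by (simp add: prime_factors_product prod.union_inter)
  moreover have "(\<Prod>p\<in>?I. p) \<ge> 1"
    by (intro prod_ge_1) (auto simp: in_prime_factors_iff prime_ge_1_nat)
  ultimately show ?thesis
    by (metis mult.right_neutral mult_le_mono2)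
qed

lemma finite_solutions: "finite (solutions c)"
  by (rule finite_subset[of _ "{..c} \<times> {..c}"]) (auto simp: solutions_def)

text \<open>Each solution yields two totatives of \<open>c\<close>. Either entry determines the
  other through the sum \<open>c\<close>, so both projections are injective; their images are
  disjoint because \<open>a\<close> lies below c/2 and \<open>b\<close> above it.\<close>

lemma card_solutions_le: "2 * card (solutions c) \<le> totient c"
proof -
  let ?A = "fst ` solutions c" and ?B = "snd ` solutions c"
  have "card ?A = card (solutions c)" "card ?B = card (solutions c)"
    by (auto intro!: card_image inj_onI simp: solutions_def)
  moreover have "?A \<inter> ?B = {}"
    by (auto simp: solutions_def)
  ultimately have "2 * card (solutions c) = card (?A \<union> ?B)"
    by (simp add: card_Un_disjoint finite_solutions)
  also have "\<dots> \<le> card (totatives c)"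
  proof (intro card_mono subsetI)
    fix x assume "x \<in> ?A \<union> ?B"
    then have "x > 0 \<and> (\<exists>y. coprime x y \<and> c = x + y)"
      by (auto simp: solutions_def coprime_commute add.commute)
    then obtain y where y: "x > 0" "coprime x y" "c = x + y"
      by blast
    \<comment> \<open>A common divisor of \<open>x\<close> and \<open>x + y\<close> also divides
      \<open>y\<close>.\<close>
    then have "coprime x c"
      by (metis coprime_iff_gcd_eq_1 gcd_add2)
    with y show "x \<in> totatives c"
      by (simp add: totatives_def coprime_commute)
  qed simp
  finally show ?thesis
    by (simp add: totient_def)
qed

text \<open>Only the factor \<open>c\<close> keeps its radical; \<open>rad (a * b)\<close> is
  bounded by \<open>a * b\<close> and then by \<open>c * c\<close>, which gives one bound for all
  solutions.\<close>

lemma G_le: "G c \<le> (rad c * c\<^sup>2) ^ card (solutions c)"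
proof -
  have "rad (a * b * c) \<le> rad c * c\<^sup>2" if "(a, b) \<in> solutions c" for a b
  proof -
    from that have ab: "a > 0" "b > 0" "a \<le> c" "b \<le> c"
      by (auto simp: solutions_def)
    then have "rad (a * b * c) \<le> rad (a * b) * rad c"
      by (intro rad_mult_le) auto
    also have "\<dots> \<le> (a * b) * rad c"
      using ab by (intro mult_right_mono rad_le) auto
    also have "\<dots> \<le> (c * c) * rad c"
      using ab by (intro mult_right_mono mult_mono) auto
    finally show ?thesis
      by (simp add: power2_eq_square mult_ac)
  qed
  then have "G c \<le> (\<Prod>_\<in>solutions c. rad c * c\<^sup>2)"
    unfolding G_def by (intro prod_mono) auto
  then show ?thesis by simp
qed

lemma G_powr_le:
  assumes "c > 0"
  shows "real (G c) powr (2 / real (totient c)) \<le> real (rad c) * real c ^ 2"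
proof -
  define M where "M = real (rad c * c\<^sup>2)"
  \<comment> \<open>A base of at least 1 makes \<open>powr\<close> monotone in the exponent, so an
    upper bound on the number of solutions suffices below.\<close>
  have M: "M \<ge> 1"
    using assms rad_pos[of c] by (simp add: M_def Suc_le_eq del: of_nat_mult)
  have t: "totient c > 0"
    using assms by simp
  have "real (G c) \<le> M ^ card (solutions c)"
    using G_le[of c] unfolding M_def by (metis of_nat_le_iff of_nat_power)
  also have "\<dots> = M powr real (card (solutions c))"
    using M by (simp add: powr_realpow)
  finally have "real (G c) powr (2 / real (totient c)) \<le>
      (M powr real (card (solutions c))) powr (2 / real (totient c))"
    by (intro powr_mono2) auto
  also have "\<dots> = M powr (real (2 * card (solutions c)) / real (totient c))"
    by (simp add: powr_powr mult.commute)
  also have "\<dots> \<le> M powr 1"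
    using M t card_solutions_le[of c] by (intro powr_mono) (auto simp del: of_nat_mult)
  finally show ?thesis
    using M by (simp add: M_def)
qed

theorem theorem5:
  shows "\<exists>k5 k6 :: real. k5 > 0 \<and> k6 > 1 \<and>
    (\<forall>c :: nat. c \<ge> 3 \<longrightarrow>
      real (G c) powr (2 / real (totient c)) <
        k5 * k6 ^ (3 ^ omega c) * real (rad c) * real c ^ 2)"
proof (intro exI conjI allI impI)
  fix c :: nat assume c: "c \<ge> 3"
  let ?M = "real (rad c) * real c ^ 2"
  have "?M > 0"
    using c rad_pos[of c] by simp
  \<comment> \<open>Strictness comes from here: the exponent \<open>3 ^ omega c\<close> is
    positive.\<close>
  moreover have "(1::real) < 2 ^ (3 ^ omega c)"
    by (intro one_less_power) auto
  ultimately have "1 * ?M < 2 ^ (3 ^ omega c) * ?M"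
    by (intro mult_strict_right_mono)
  then show "real (G c) powr (2 / real (totient c)) <
      1 * 2 ^ (3 ^ omega c) * real (rad c) * real c ^ 2"
    using G_powr_le[of c] c by (simp add: mult.assoc)
qed auto

end
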